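(* Let $\alpha\in(0,1)$ be irrational, $Tx=x+\alpha$ on $\mathbb T$, $d\ge1$, $\psi(x)=\{x\}-\frac12$ and $S_\beta(x)=x+\beta$. Then for $\mu^{\otimes d}$-almost every $(\beta_1,\dots,\beta_d)\in\mathbb T^d$ the cocycle $(\psi,\psi\circ S_{\beta_1},\dots,\psi\circ S_{\beta_d}):\mathbb T\to\mathbb R^{d+1}$ is ergodic over $T$.
   Context: $\mathbb T=[0,1)$ is the additive circle (addition mod $1$) with Lebesgue measure $\mu$; $\{x\}$ is the fractional part. A cocycle $\Phi:\mathbb T\to\mathbb R^m$ (a measurable function) is ergodic over $T$ if the skew product $T_\Phi(x,g)=(Tx,g+\Phi(x))$ is ergodic on $\mathbb T\times\mathbb R^m$ for the product of $\mu$ and Lebesgue measure on $\mathbb R^m$. *)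

theory Defs
  imports "HOL-Analysis.Analysis"
begin

text \<open>
  The circle is represented by its fundamental domain \<open>{0..<1}\<close> as a set of reals;
  \<open>rotation\<close> is addition mod 1, so it maps this set to itself.
\<close>

definition circle :: "real measure" where
  "circle = restrict_space lborel {0..<1}"

definition rotation :: "real \<Rightarrow> real \<Rightarrow> real" where
  "rotation a x = frac (x + a)"

definition sawtooth :: "real \<Rightarrow> real" where
  "sawtooth x = frac x - 1 / 2"

text \<open>
  The measure is not assumed finite, so triviality of invariant sets is phrased
  by null complements.
\<close>

definition ergodic :: "'a measure \<Rightarrow> ('a \<Rightarrow> 'a) \<Rightarrow> bool" where
  "ergodic M T \<longleftrightarrow>
     T \<in> M \<rightarrow>\<^sub>M M \<and> distr M M T = M \<and>
     (\<forall>A\<in>sets M. T -` A \<inter> space M = A \<longrightarrow> A \<in> null_sets M \<or> space M - A \<in> null_sets M)"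

definition skew_product ::
    "('a \<Rightarrow> 'a) \<Rightarrow> ('a \<Rightarrow> 'b::euclidean_space) \<Rightarrow> 'a \<times> 'b \<Rightarrow> 'a \<times> 'b" where
  "skew_product T \<Phi> = (\<lambda>(x, g). (T x, g + \<Phi> x))"

definition ergodic_cocycle ::
    "'a measure \<Rightarrow> ('a \<Rightarrow> 'a) \<Rightarrow> ('a \<Rightarrow> 'b::euclidean_space) \<Rightarrow> bool" where
  "ergodic_cocycle M T \<Phi> \<longleftrightarrow>
     \<Phi> \<in> borel_measurable M \<and> ergodic (M \<Otimes>\<^sub>M lborel) (skew_product T \<Phi>)"

text \<open>
  With \<open>d = CARD('d)\<close>, the space \<open>\<real>\<^sup>d\<^sup>+\<^sup>1\<close> is \<open>real ^ 'd option\<close>: coordinate \<open>None\<close> is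
  the unshifted function, coordinate \<open>Some i\<close> the one shifted by \<open>\<beta> i\<close>.
\<close>

definition shifted_tuple :: "(real \<Rightarrow> real) \<Rightarrow> ('d::finite \<Rightarrow> real) \<Rightarrow> real \<Rightarrow> real ^ 'd option" where
  "shifted_tuple f \<beta> x =
     (\<chi> k. case k of None \<Rightarrow> f x | Some i \<Rightarrow> (f \<circ> rotation (\<beta> i)) x)"

end

theory Submission
  imports Defs
begin

text \<open>
  If \<open>\<bar>\<alpha> - p/q\<bar> < 1/q\<^sup>2\<close> with \<open>p, q\<close> coprime, the Birkhoff sums \<open>F\<^sub>q\<close> of the cocycle over \<open>q\<close> steps
  are bounded (Denjoy and Koksma), while modulo 1 their \<open>k\<close>-th coordinate is
  \<open>q x + q b\<^sub>k + c\<^sub>q\<close> with \<open>c\<^sub>q\<close> independent of \<open>x\<close> and \<open>k\<close>. For almost every \<open>\<beta>\<close> and every target \<open>v\<close>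
  there are such \<open>q\<close> with \<open>q b\<^sub>k\<close> close to \<open>v\<^sub>k - v\<^sub>0\<close> modulo 1, and then \<open>F\<^sub>q(x)\<close> accumulates at
  \<open>v\<close> modulo \<open>\<int>\<^sup>d\<^sup>+\<^sup>1\<close> for almost every \<open>x\<close>. As \<open>q \<alpha>\<close> tends to 0 modulo 1, translation continuity
  shows that each accumulation point stabilizes, up to null sets, the fibre over \<open>x\<close> of any invariant set.
  So every vector lies in the stabilizer up to an integer vector of bounded size; a pigeonhole
  argument removes the integer vector. Hence almost every fibre is null or conull, and the
  irrational rotation decides which.
\<close>

section \<open>Translations of Borel sets and their stabilizers\<close>

text \<open>Each \<open>P k\<close> holds at arbitrarily large indices, so dependent choice can
  place the index for \<open>Suc k\<close> beyond that for \<open>k\<close>. Letting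
  \<open>P\<close> vary with \<open>k\<close> accommodates shrinking tolerances.\<close>

lemma frequently_subseq:
  fixes P :: "nat \<Rightarrow> nat \<Rightarrow> bool"
  assumes "\<And>k. \<exists>\<^sub>\<infinity>n. P k n"
  obtains r where "strict_mono r" "\<And>k. P k (r k)"
proof -
  have "\<exists>f. \<forall>n. P n (f n) \<and> f n < f (Suc n)"
  proof (rule dependent_nat_choice)
    show "\<exists>x. P 0 x"
      using assms[of 0] by (meson INFM_EX)
    show "\<exists>y. P (Suc n) y \<and> x < y" for x n
      using assms[of "Suc n"] unfolding INFM_nat by blast
  qed
  then show thesis
    using that strict_mono_Suc_iff by blast
qed

lemma emeasure_lborel_translation:
  fixes V :: "'a::euclidean_space set"
  assumes "V \<in> sets borel"
  shows "emeasure lborel {z. z + h \<in> V} = emeasure lborel V"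
proof -
  have "emeasure lborel V = emeasure (distr lborel borel ((+) h)) V"
    by (simp add: lborel_distr_plus)
  also have "\<dots> = emeasure lborel ((+) h -` V \<inter> space lborel)"
    using assms by (intro emeasure_distr) auto
  also have "(+) h -` V \<inter> space lborel = {z. z + h \<in> V}"
    by (auto simp: add.commute)
  finally show ?thesis by simp
qed

lemma AE_lborel_translation:
  fixes h :: "'a::euclidean_space"
  assumes "AE z in lborel. P z"
  shows "AE z in lborel. P (z + h)"
proof -
  obtain N where N: "N \<in> null_sets lborel" "{z \<in> space lborel. \<not> P z} \<subseteq> N"
    using assms unfolding eventually_ae_filter by auto
  have "{z. z - (- h) \<in> N} \<in> null_sets lborel"
    by (rule null_sets_translation) (rule N)
  moreover have "{z \<in> space lborel. \<not> P (z + h)} \<subseteq> {z. z - (- h) \<in> N}"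
    using N(2) by auto
  ultimately show ?thesis
    unfolding eventually_ae_filter by blast
qed

text \<open>Squeeze the bounded part of \<open>S\<close> between a compact \<open>K\<close> and an
  open \<open>U\<close> with \<open>U - K\<close> of small measure. A translation shorter than the
  distance from \<open>K\<close> to the complement of \<open>U\<close> changes membership only where
  \<open>z\<close> or \<open>z + h\<close> lies in \<open>U - K\<close>.\<close>

lemma emeasure_translation_diff_small:
  fixes S :: "'a::euclidean_space set"
  assumes S: "S \<in> sets borel" and "0 < e"
  shows "\<exists>d>0. \<forall>h. norm h < d \<longrightarrow>
           emeasure lborel {z \<in> cball 0 R. (z + h \<in> S) \<noteq> (z \<in> S)} < ennreal e"
proof -
  \<comment> \<open>The margin 1 keeps \<open>z\<close> and \<open>z + h\<close> inside the
    truncation when \<open>norm h < 1\<close>; boundedness makes \<open>K\<close> compact.\<close>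
  define S' where "S' = S \<inter> cball 0 (R + 1)"
  have S': "S' \<in> sets borel" and leb: "S' \<in> sets lebesgue"
    using S by (auto simp: S'_def)
  obtain K where K: "closed K" "K \<subseteq> S'" "emeasure lebesgue (S' - K) < ennreal (e/4)"
    using sets_lebesgue_inner_closed[OF leb, of "e/4"] \<open>0 < e\<close>
    by (metis divide_pos_pos zero_less_numeral)
  obtain U where U: "open U" "S' \<subseteq> U" "emeasure lebesgue (U - S') < ennreal (e/4)"
    using sets_lebesgue_outer_open[OF leb, of "e/4"] \<open>0 < e\<close>
    by (metis divide_pos_pos zero_less_numeral)
  have mK [measurable]: "K \<in> sets borel" and mU [measurable]: "U \<in> sets borel"
    using K U by auto
  have "bounded K"
    using K(2) unfolding S'_def by (meson bounded_cball bounded_subset inf.bounded_iff)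
  then have "compact K"
    using K(1) compact_eq_bounded_closed by blast
  moreover have "closed (- U)" "K \<inter> - U = {}"
    using K U by auto
  ultimately obtain d where d: "d > 0" "\<And>x y. x \<in> K \<Longrightarrow> y \<in> - U \<Longrightarrow> d \<le> dist x y"
    using separate_compact_closed[of K "- U"] by blast
  have "emeasure lborel (U - K) = emeasure lborel ((S' - K) \<union> (U - S'))"
    using K U by (intro arg_cong[where f="emeasure lborel"]) auto
  also have "\<dots> \<le> emeasure lborel (S' - K) + emeasure lborel (U - S')"
    using S' by (intro emeasure_subadditive) auto
  also have "\<dots> < ennreal (e/4) + ennreal (e/4)"
    using K(3) U(3) S' by (intro add_strict_mono) auto
  also have "\<dots> = ennreal (e/2)"
    using \<open>0 < e\<close> by (simp flip: ennreal_plus)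
  finally have UK: "emeasure lborel (U - K) < ennreal (e/2)" .
  have "emeasure lborel {z \<in> cball 0 R. (z + h \<in> S) \<noteq> (z \<in> S)} < ennreal e"
    if h: "norm h < min d 1" for h
  proof -
    have "{z \<in> cball 0 R. (z + h \<in> S) \<noteq> (z \<in> S)} \<subseteq> (U - K) \<union> {z. z + h \<in> U - K}"
    proof
      fix z assume z: "z \<in> {z \<in> cball 0 R. (z + h \<in> S) \<noteq> (z \<in> S)}"
      then have "norm (z + h) \<le> R + 1" "norm z \<le> R + 1"
        using h norm_triangle_ineq[of z h] by auto
      with z have zS: "(z + h \<in> S') \<noteq> (z \<in> S')"
        by (auto simp: S'_def)
      have "z + h \<in> U" if "z \<in> K"
        using d(2)[OF that, of "z + h"] h by (auto simp: dist_norm)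
      moreover have "z \<in> U" if "z + h \<in> K"
        using d(2)[OF that, of z] h by (auto simp: dist_norm)
      ultimately show "z \<in> (U - K) \<union> {z. z + h \<in> U - K}"
        using zS K(2) U(2) by auto
    qed
    then have "emeasure lborel {z \<in> cball 0 R. (z + h \<in> S) \<noteq> (z \<in> S)}
                 \<le> emeasure lborel ((U - K) \<union> {z. z + h \<in> U - K})"
      by (rule emeasure_mono) measurable
    also have "\<dots> \<le> emeasure lborel (U - K) + emeasure lborel {z. z + h \<in> U - K}"
      by (intro emeasure_subadditive) measurable
    also have "\<dots> = emeasure lborel (U - K) + emeasure lborel (U - K)"
      by (subst emeasure_lborel_translation) auto
    finally have *: "emeasure lborel {z \<in> cball 0 R. (z + h \<in> S) \<noteq> (z \<in> S)}
        \<le> emeasure lborel (U - K) + emeasure lborel (U - K)" .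
    show ?thesis
    proof -
      note *
      also have "emeasure lborel (U - K) + emeasure lborel (U - K) < ennreal (e/2) + ennreal (e/2)"
        using UK by (intro add_strict_mono)
      also have "\<dots> = ennreal e"
        using \<open>0 < e\<close> by (simp flip: ennreal_plus)
      finally show ?thesis .
    qed
  qed
  then show ?thesis
    using d(1) by (intro exI[of _ "min d 1"]) auto
qed

text \<open>Convergence in measure gives almost sure convergence along a subsequence: exceptional
  sets of measure below \<open>(1/2) ^ k\<close> are summable, and the first Borel-Cantelli lemma
  applies.\<close>

lemma AE_translation_subseq:
  fixes S :: "'a::euclidean_space set"
  assumes S [measurable]: "S \<in> sets borel" and h: "h \<longlonglongrightarrow> 0"
  obtains r :: "nat \<Rightarrow> nat" where "strict_mono r"
    "AE z in lborel. \<forall>\<^sub>F n in sequentially. z + h (r n) \<in> S \<longleftrightarrow> z \<in> S"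
proof -
  \<comment> \<open>The radius grows with \<open>k\<close>, so every point lies in all but finitely
    many of the balls.\<close>
  define D where "D k n = {z \<in> cball 0 (real k). (z + h n \<in> S) \<noteq> (z \<in> S)}" for k n
  have D [measurable]: "D k n \<in> sets borel" for k n
    unfolding D_def by measurable
  have "\<exists>\<^sub>\<infinity>n. emeasure lborel (D k n) < ennreal ((1/2) ^ k)" for k
  proof -
    obtain d where "d > 0" "\<And>x. norm x < d \<Longrightarrow>
        emeasure lborel {z \<in> cball 0 (real k). (z + x \<in> S) \<noteq> (z \<in> S)} < ennreal ((1/2)^k)"
      using emeasure_translation_diff_small[OF S, of "(1/2)^k" "real k"] by auto
    moreover from this have "\<forall>\<^sub>F n in sequentially. norm (h n) < d"
      using h by (simp add: tendsto_iff)
    ultimately have "\<forall>\<^sub>F n in sequentially. emeasure lborel (D k n) < ennreal ((1/2) ^ k)"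
      unfolding D_def by (auto elim: eventually_mono)
    then show ?thesis
      using eventually_frequently[of sequentially] by (simp add: cofinite_eq_sequentially)
  qed
  then obtain r where r: "strict_mono r" "\<And>k. emeasure lborel (D k (r k)) < ennreal ((1/2) ^ k)"
    using frequently_subseq[of "\<lambda>k n. emeasure lborel (D k n) < ennreal ((1/2) ^ k)"] by blast
  have fin: "emeasure lborel (D k (r k)) < \<infinity>" for k
    using r(2)[of k] by (simp add: less_top order.strict_trans[OF _ ennreal_less_top])
  have "measure lborel (D k (r k)) \<le> (1/2)^k" for k
    using r(2)[of k] by (simp add: measure_def enn2real_leI less_imp_le)
  then have "summable (\<lambda>k. measure lborel (D k (r k)))"
    by (intro summable_comparison_test[OF _ summable_geometric[of "1/2::real"]]) auto
  then have "AE z in lborel. \<forall>\<^sub>F k in sequentially. z \<in> space lborel - D k (r k)"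
    using fin by (intro borel_cantelli_AE1) auto
  then have "AE z in lborel. \<forall>\<^sub>F n in sequentially. z + h (r n) \<in> S \<longleftrightarrow> z \<in> S"
  proof (rule AE_mp, intro AE_I2 impI)
    fix z assume "\<forall>\<^sub>F k in sequentially. z \<in> space lborel - D k (r k)"
    moreover have "\<forall>\<^sub>F k in sequentially. z \<in> cball 0 (real k)"
      using eventually_ge_at_top[of "nat \<lceil>norm z\<rceil>"] by eventually_elim (simp add: nat_le_iff, linarith)
    ultimately show "\<forall>\<^sub>F n in sequentially. z + h (r n) \<in> S \<longleftrightarrow> z \<in> S"
      by eventually_elim (auto simp: D_def)
  qed
  with r(1) show thesis by (rule that)
qed

text \<open>Invariance is required modulo null sets only; for Borel \<open>S\<close> this yields a
  closed subgroup, as the following lemmas show.\<close>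

definition stabilizer :: "'a::euclidean_space set \<Rightarrow> 'a set" where
  "stabilizer S = {c. AE z in lborel. z + c \<in> S \<longleftrightarrow> z \<in> S}"

lemma stabilizer_minus: "c \<in> stabilizer S \<Longrightarrow> - c \<in> stabilizer S"
  using AE_lborel_translation[of "\<lambda>z. z + c \<in> S \<longleftrightarrow> z \<in> S" "- c"]
  by (simp add: stabilizer_def eq_commute)

lemma stabilizer_add:
  assumes "b \<in> stabilizer S" "c \<in> stabilizer S"
  shows "b + c \<in> stabilizer S"
proof -
  have "AE z in lborel. z + b + c \<in> S \<longleftrightarrow> z + b \<in> S"
    using AE_lborel_translation[of "\<lambda>z. z + c \<in> S \<longleftrightarrow> z \<in> S" b] assms(2)
    by (simp add: stabilizer_def)
  moreover have "AE z in lborel. z + b \<in> S \<longleftrightarrow> z \<in> S"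
    using assms(1) by (simp add: stabilizer_def)
  ultimately have "AE z in lborel. z + (b + c) \<in> S \<longleftrightarrow> z \<in> S"
    by eventually_elim (simp add: add.assoc)
  then show ?thesis
    by (simp add: stabilizer_def)
qed

lemma stabilizer_diff: "b \<in> stabilizer S \<Longrightarrow> c \<in> stabilizer S \<Longrightarrow> b - c \<in> stabilizer S"
  using stabilizer_add[OF _ stabilizer_minus, of b S c] by simp

lemma stabilizer_scaleR:
  assumes "c \<in> stabilizer S"
  shows "real n *\<^sub>R c \<in> stabilizer S"
proof (induction n)
  case 0
  show ?case by (simp add: stabilizer_def)
next
  case (Suc n)
  then show ?case
    using stabilizer_add[OF assms Suc] by (simp add: algebra_simps)
qed

text \<open>Each \<open>z\<close> may have its own threshold for \<open>n\<close>, which is how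
  Birkhoff sums deliver invariance. Write \<open>z + c n\<close> as
  \<open>(z + l) + (c n - l)\<close>: along a subsequence the vanishing correction eventually
  preserves membership, so \<open>z + l\<close> and \<open>z\<close> are compared with the same
  points.\<close>

lemma stabilizer_limit:
  assumes S: "S \<in> sets borel" and c: "c \<longlonglongrightarrow> l"
    and ev: "AE z in lborel. \<forall>\<^sub>F n in sequentially. z + c n \<in> S \<longleftrightarrow> z \<in> S"
  shows "l \<in> stabilizer S"
proof -
  have "(\<lambda>n. c n - l) \<longlonglongrightarrow> 0"
    using c by (simp add: LIM_zero)
  then obtain r where r: "strict_mono r"
    "AE z in lborel. \<forall>\<^sub>F n in sequentially. z + (c (r n) - l) \<in> S \<longleftrightarrow> z \<in> S"
    using AE_translation_subseq[OF S, of "\<lambda>n. c n - l"] by blast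
  have "AE z in lborel. \<forall>\<^sub>F n in sequentially. z + c (r n) \<in> S \<longleftrightarrow> z + l \<in> S"
    using AE_lborel_translation[OF r(2), of l] by (simp add: algebra_simps)
  moreover have "AE z in lborel. \<forall>\<^sub>F n in sequentially. z + c (r n) \<in> S \<longleftrightarrow> z \<in> S"
    using ev by eventually_elim (rule eventually_subseq[OF r(1)])
  ultimately have "AE z in lborel. z + l \<in> S \<longleftrightarrow> z \<in> S"
  proof eventually_elim
    case (elim z)
    then have "\<forall>\<^sub>F n in sequentially. z + l \<in> S \<longleftrightarrow> z \<in> S"
      by eventually_elim auto
    then show ?case by simp
  qed
  then show ?thesis
    by (simp add: stabilizer_def)
qed

lemma closed_stabilizer:
  assumes "S \<in> sets borel"
  shows "closed (stabilizer S)"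
  unfolding closed_sequential_limits
proof (intro allI impI, elim conjE)
  fix c l assume c: "\<forall>n. c n \<in> stabilizer S" and lim: "c \<longlonglongrightarrow> l"
  from c have "AE z in lborel. \<forall>n. z + c n \<in> S \<longleftrightarrow> z \<in> S"
    by (simp add: stabilizer_def AE_all_countable)
  then have "AE z in lborel. \<forall>\<^sub>F n in sequentially. z + c n \<in> S \<longleftrightarrow> z \<in> S"
    by eventually_elim simp
  with assms lim show "l \<in> stabilizer S"
    by (rule stabilizer_limit)
qed

text \<open>By Fubini a single \<open>z\<close> agrees with \<open>z + c\<close> for almost every
  \<open>c\<close>; translating by \<open>- z\<close>, membership in \<open>S\<close> is almost
  everywhere the value it has at \<open>z\<close>.\<close>

lemma stabilizer_UNIV_imp_trivial:
  fixes S :: "'a::euclidean_space set"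
  assumes [measurable]: "S \<in> sets borel" and "stabilizer S = UNIV"
  shows "(AE z in lborel. z \<in> S) \<or> (AE z in lborel. z \<notin> S)"
proof -
  have m: "{p \<in> space (lborel \<Otimes>\<^sub>M lborel). (snd p + fst p \<in> S) = (snd p \<in> S)}
      \<in> sets (lborel \<Otimes>\<^sub>M lborel :: ('a \<times> 'a) measure)"
    by measurable
  have "AE c in lborel. AE z in lborel. z + c \<in> S \<longleftrightarrow> z \<in> S"
    using assms(2) by (auto simp: stabilizer_def)
  then have "AE z in lborel. AE c in lborel. z + c \<in> S \<longleftrightarrow> z \<in> S"
    using lborel_pair.AE_commute[of "\<lambda>c z. (z + c \<in> S) = (z \<in> S)", OF m] by simp
  \<comment> \<open>Lebesgue measure is nonzero, so a property that holds almost everywhere has a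
    witness.\<close>
  moreover have "\<not> (AE z::'a in lborel. False)"
    by (simp flip: trivial_limit_def add: ae_filter_eq_bot_iff)
  ultimately have "\<exists>z. AE c in lborel. z + c \<in> S \<longleftrightarrow> z \<in> S"
    by (metis (mono_tags, lifting) eventually_mono)
  then obtain z where "AE c in lborel. z + c \<in> S \<longleftrightarrow> z \<in> S"
    by blast
  then have "AE c in lborel. c \<in> S \<longleftrightarrow> z \<in> S"
    using AE_lborel_translation[of "\<lambda>c. z + c \<in> S \<longleftrightarrow> z \<in> S" "- z"] by simp
  then show ?thesis
    by (cases "z \<in> S") auto
qed

section \<open>Multiples of almost every point are dense modulo 1\<close>

definition near_int :: "real \<Rightarrow> real \<Rightarrow> bool" where
  "near_int d x \<longleftrightarrow> (\<exists>k::int. \<bar>x - of_int k\<bar> < d)"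

lemma measurable_near_int [measurable]: "Measurable.pred borel (near_int d)"
  unfolding near_int_def by measurable

text \<open>Steps of length \<open>d\<close> cannot jump over the window of radius \<open>d\<close>
  around the next integer, and \<open>M\<close> of them cover a distance of at least 1.\<close>

lemma near_int_shift:
  assumes "0 < d" "real M * d \<ge> 1"
  shows "\<exists>i\<le>M. near_int d (y + real i * d)"
proof -
  \<comment> \<open>The real number of steps from \<open>y\<close> up to the next integer; its floor
    is the required \<open>i\<close>.\<close>
  define t where "t = (of_int \<lceil>y\<rceil> - y) / d"
  have t: "0 \<le> t" "t \<le> real M"
    using assms ceiling_correct[of y] by (auto simp: t_def divide_simps; linarith)+
  have fl: "of_int \<lfloor>t\<rfloor> \<le> t" "t < of_int \<lfloor>t\<rfloor> + 1"
    by linarith+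
  have "t * d = of_int \<lceil>y\<rceil> - y"
    using assms by (simp add: t_def)
  moreover have "of_int \<lfloor>t\<rfloor> * d \<le> t * d" "t * d < (of_int \<lfloor>t\<rfloor> + 1) * d"
    using fl assms by (auto intro: mult_right_mono mult_strict_right_mono)
  ultimately have "\<bar>y + of_int \<lfloor>t\<rfloor> * d - of_int \<lceil>y\<rceil>\<bar> < d"
    by (auto simp: algebra_simps abs_if)
  then have "near_int d (y + real (nat \<lfloor>t\<rfloor>) * d)"
    using t by (auto simp: near_int_def)
  moreover have "nat \<lfloor>t\<rfloor> \<le> M"
    using t by linarith
  ultimately show ?thesis by blast
qed

text \<open>
  The set \<open>S N\<close> of points that are bad from index \<open>N\<close> on is null: each of its points leaves it under one
  of the finitely many translations \<open>i d / q n\<close>, which tend to 0.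
\<close>

lemma AE_near_int:
  fixes q :: "nat \<Rightarrow> nat" and c :: "nat \<Rightarrow> real"
  assumes q: "strict_mono q" and d: "0 < d"
  shows "AE x in lborel. \<exists>\<^sub>\<infinity>n. near_int d (real (q n) * x + c n)"
proof -
  define S where "S N = {x. \<forall>n\<ge>N. \<not> near_int d (real (q n) * x + c n)}" for N
  have S [measurable]: "S N \<in> sets borel" for N
    unfolding S_def by measurable
  obtain M :: nat where M: "1 < real M * d"
    using reals_Archimedean3[OF d] by blast
  have small: "emeasure lborel (S N \<inter> cball 0 R) \<le> 0 + ennreal e" if "0 < e" for N R e
  proof -
    define D where "D h = {z \<in> cball 0 R. (z + h \<in> S N) \<noteq> (z \<in> S N)}" for h
    have D [measurable]: "D h \<in> sets borel" for h
      unfolding D_def by measurable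
    \<comment> \<open>The error \<open>e\<close> is shared among the \<open>M + 1\<close> shifts
      \<open>i = 0, ..., M\<close>.\<close>
    have e: "0 < e / (real M + 1)"
      using that by simp
    obtain \<delta> where \<delta>: "\<delta> > 0" "\<And>h. norm h < \<delta> \<Longrightarrow> emeasure lborel (D h) < ennreal (e / (real M + 1))"
      using emeasure_translation_diff_small[OF S e, of R] unfolding D_def by blast
    obtain m :: nat where m: "real M * d < real m * \<delta>"
      using reals_Archimedean3[OF \<delta>(1)] by blast
    \<comment> \<open>Being at least \<open>N\<close> makes \<open>n\<close> an index tested by
      \<open>S N\<close>. Since \<open>q n \<ge> n\<close>, being above \<open>m\<close> makes every
      shift shorter than \<delta> and \<open>q n\<close> positive.\<close>
    define n where "n = max N (Suc m)"
    have "q n \<ge> Suc m"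
      using strict_mono_imp_increasing[OF q, of n] by (auto simp: n_def)
    then have qn: "real (q n) \<ge> real m" "real (q n) > 0"
      by auto
    have "S N \<inter> cball 0 R \<subseteq> (\<Union>i\<le>M. D (real i * d / real (q n)))"
    proof
      fix x assume x: "x \<in> S N \<inter> cball 0 R"
      obtain i where i: "i \<le> M" "near_int d ((real (q n) * x + c n) + real i * d)"
        using near_int_shift[OF d, of M] M by force
      have "near_int d (real (q n) * (x + real i * d / real (q n)) + c n)"
        using i(2) qn(2) by (simp add: algebra_simps)
      then have "x + real i * d / real (q n) \<notin> S N"
        unfolding S_def using max.cobounded1[of N "Suc m"] by (auto simp flip: n_def)
      with x i(1) show "x \<in> (\<Union>i\<le>M. D (real i * d / real (q n)))"
        by (auto simp: D_def)
    qed
    then have "emeasure lborel (S N \<inter> cball 0 R) \<le> emeasure lborel (\<Union>i\<le>M. D (real i * d / real (q n)))"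
      by (rule emeasure_mono) auto
    also have "\<dots> \<le> (\<Sum>i\<le>M. emeasure lborel (D (real i * d / real (q n))))"
      by (rule emeasure_subadditive_finite) auto
    also have "\<dots> \<le> (\<Sum>i\<le>M. ennreal (e / (real M + 1)))"
    proof (rule sum_mono)
      fix i assume "i \<in> {..M}"
      then have "real i * d \<le> real M * d"
        using d by simp
      also have "\<dots> < real (q n) * \<delta>"
        using m qn(1) \<delta>(1) by (intro less_le_trans[OF m] mult_right_mono) auto
      finally have "norm (real i * d / real (q n)) < \<delta>"
        using qn(2) d by (simp add: divide_simps mult.commute)
      then show "emeasure lborel (D (real i * d / real (q n))) \<le> ennreal (e / (real M + 1))"
        by (intro less_imp_le \<delta>(2))
    qed
    also have "\<dots> = ennreal (\<Sum>i\<le>M. e / (real M + 1))"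
      using e by (intro sum_ennreal) auto
    also have "(\<Sum>i\<le>M. e / (real M + 1)) = e"
      by (simp add: add.commute[of 1])
    finally show ?thesis by simp
  qed
  have "emeasure lborel (S N \<inter> cball 0 R) = 0" for N R
  proof -
    have "emeasure lborel (S N \<inter> cball 0 R) \<le> 0"
      by (rule ennreal_le_epsilon) (rule small)
    then show ?thesis by simp
  qed
  then have "AE x in lborel. x \<notin> S N \<inter> cball 0 (real R)" for N R
    by (intro AE_not_in) (simp add: null_sets_def)
  then have "AE x in lborel. \<forall>N R. x \<notin> S N \<inter> cball 0 (real R)"
    unfolding AE_all_countable by blast
  then show ?thesis
  proof eventually_elim
    case (elim x)
    obtain R :: nat where "norm x \<le> real R"
      using real_arch_simple by blast
    with elim have "\<forall>N. x \<notin> S N"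
      by auto
    then show ?case
      by (simp add: S_def INFM_nat_le)
  qed
qed

section \<open>Almost every point of the torus\<close>

lemma circle_simps [simp]: "space circle = {0..<1}" "sets circle = sets (restrict_space borel {0..<1})"
  by (auto simp: circle_def space_restrict_space sets_restrict_space)

lemma AE_circle_iff: "(AE x in circle. P x) \<longleftrightarrow> (AE x in lborel. 0 \<le> x \<and> x < 1 \<longrightarrow> P x)"
  unfolding circle_def by (subst AE_restrict_space_iff) auto

lemma sigma_finite_circle: "sigma_finite_measure circle"
  unfolding circle_def by (intro sigma_finite_measure_restrict_space lborel.sigma_finite_measure_axioms) auto

lemma INFM_subseqI:
  fixes r :: "nat \<Rightarrow> nat"
  assumes "strict_mono r" "\<exists>\<^sub>\<infinity>n. P (r n)"
  shows "\<exists>\<^sub>\<infinity>n. P n"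
  unfolding INFM_nat_le
proof
  fix m
  obtain n where "n \<ge> m" "P (r n)"
    using assms(2) unfolding INFM_nat_le by blast
  then show "\<exists>n\<ge>m. P n"
    using strict_mono_imp_increasing[OF assms(1), of n] order_trans by blast
qed

text \<open>Induction on the coordinates. For almost every point over \<open>I\<close> the good
  indices contain a subsequence \<open>r\<close>; \<open>AE_near_int\<close> along
  \<open>q \<circ> r\<close> makes almost every value of the new coordinate good infinitely often,
  and Fubini shows that the bad set is null.\<close>

lemma AE_PiM_near_int:
  fixes q :: "nat \<Rightarrow> nat" and c :: "nat \<Rightarrow> 'i \<Rightarrow> real"
  assumes "finite I" and q: "strict_mono q" and d: "0 < d"
  shows "AE \<beta> in (\<Pi>\<^sub>M i\<in>I. circle). \<exists>\<^sub>\<infinity>n. \<forall>i\<in>I. near_int d (real (q n) * \<beta> i + c n i)"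
  using assms(1)
proof (induction I rule: finite_induct)
  case empty
  show ?case by simp
next
  case (insert i I)
  interpret product_sigma_finite "\<lambda>_::'i. circle"
    by (simp add: product_sigma_finite_def sigma_finite_circle)
  define P where "P \<beta> \<longleftrightarrow> (\<exists>\<^sub>\<infinity>n. \<forall>i\<in>insert i I. near_int d (real (q n) * \<beta> i + c n i))" for \<beta>
  define N where "N = {\<beta> \<in> space (\<Pi>\<^sub>M i\<in>insert i I. circle). \<not> P \<beta>}"
  have comp: "(\<lambda>\<beta>. \<beta> j) \<in> borel_measurable (\<Pi>\<^sub>M i\<in>insert i I. circle)" if "j \<in> insert i I" for j
    by (rule measurable_compose[OF measurable_component_singleton[OF that]])
       (simp add: circle_def measurable_restrict_space1)
  have "Measurable.pred (\<Pi>\<^sub>M i\<in>insert i I. circle) (\<lambda>\<beta>. near_int d (real (q n) * \<beta> j + c n j))"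
    if "j \<in> insert i I" for n j
    using comp[OF that] by measurable
  then have [measurable]: "Measurable.pred (\<Pi>\<^sub>M i\<in>insert i I. circle)
      (\<lambda>\<beta>. \<forall>j\<in>insert i I. near_int d (real (q n) * \<beta> j + c n j))" for n
    using insert.hyps(1) by (intro pred_intros_finite) auto
  have [measurable]: "N \<in> sets (\<Pi>\<^sub>M i\<in>insert i I. circle)"
    unfolding N_def P_def INFM_nat by measurable
  have "AE x in (\<Pi>\<^sub>M i\<in>I. circle). (\<integral>\<^sup>+y. indicator N (x(i := y)) \<partial>circle) = 0"
    using insert.IH
  proof eventually_elim
    case (elim x)
    then obtain r :: "nat \<Rightarrow> nat" where r: "strict_mono r" "\<And>n. \<forall>j\<in>I. near_int d (real (q (r n)) * x j + c (r n) j)"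
      using frequently_subseq[of "\<lambda>_ n. \<forall>j\<in>I. near_int d (real (q n) * x j + c n j)"] by blast
    have "AE y in lborel. \<exists>\<^sub>\<infinity>n. near_int d (real (q (r n)) * y + c (r n) i)"
      using AE_near_int[of "q \<circ> r" d "\<lambda>n. c (r n) i"] q r(1) d by (simp add: strict_mono_o)
    then have "AE y in circle. \<exists>\<^sub>\<infinity>n. near_int d (real (q (r n)) * y + c (r n) i)"
      unfolding AE_circle_iff by eventually_elim simp
    then have "AE y in circle. indicator N (x(i := y)) = (0::ennreal)"
    proof eventually_elim
      case (elim y)
      then have "\<exists>\<^sub>\<infinity>n. \<forall>j\<in>insert i I. near_int d (real (q (r n)) * (x(i := y)) j + c (r n) j)"
        by (rule INFM_mono) (use r(2) insert.hyps(2) in auto)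
      then have "P (x(i := y))"
        unfolding P_def by (rule INFM_subseqI[OF r(1)])
      then show ?case
        by (simp add: N_def)
    qed
    then show ?case
      by (subst nn_integral_cong_AE[where v="\<lambda>_. 0"]) auto
  qed
  then have "(\<integral>\<^sup>+x. (\<integral>\<^sup>+y. indicator N (x(i := y)) \<partial>circle) \<partial>(\<Pi>\<^sub>M i\<in>I. circle)) = 0"
    by (subst nn_integral_cong_AE[where v="\<lambda>_. 0"]) auto
  then have "emeasure (\<Pi>\<^sub>M i\<in>insert i I. circle) N = 0"
    using product_nn_integral_insert[OF insert.hyps, of "indicator N"] by simp
  then have "AE \<beta> in (\<Pi>\<^sub>M i\<in>insert i I. circle). P \<beta>"
    by (intro AE_I[of _ _ N]) (simp_all flip: N_def)
  then show ?case
    by (simp add: P_def)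
qed

section \<open>Birkhoff sums of the sawtooth\<close>

lemma approx_setD:
  assumes "(p, int q) \<in> approx_set \<alpha>"
  shows "0 < q" "coprime p (int q)" "\<bar>\<alpha> - p / q\<bar> < 1 / (real q)\<^sup>2" "\<bar>real q * \<alpha> - p\<bar> < 1 / real q"
proof -
  show q: "0 < q" and "coprime p (int q)" and a: "\<bar>\<alpha> - p / q\<bar> < 1 / (real q)\<^sup>2"
    using assms by (auto simp: approx_set_def)
  have "\<bar>real q * \<alpha> - p\<bar> = real q * \<bar>\<alpha> - p / q\<bar>"
    using q by (simp add: abs_mult_pos' right_diff_distrib)
  also have "\<dots> < real q * (1 / (real q)\<^sup>2)"
    using a q by (intro mult_strict_left_mono) auto
  also have "\<dots> = 1 / real q"
    using q by (simp add: power2_eq_square)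
  finally show "\<bar>real q * \<alpha> - p\<bar> < 1 / real q" .
qed

text \<open>By Dirichlet's theorem an irrational number has infinitely many such fractions, hence
  some with arbitrarily large denominator.\<close>

lemma approx_set_strict_mono:
  assumes "\<alpha> \<notin> \<rat>"
  obtains p :: "nat \<Rightarrow> int" and q :: "nat \<Rightarrow> nat" where "strict_mono q" "\<And>n. (p n, int (q n)) \<in> approx_set \<alpha>"
proof -
  have "\<exists>\<^sub>\<infinity>q. \<exists>p. (p, int q) \<in> approx_set \<alpha>"
    unfolding INFM_nat
  proof
    fix m :: nat
    obtain h k where hk: "(h, k) \<in> approx_set \<alpha>" "k > int m"
      using infinite_approx_set[of \<alpha> "int m"] rational_iff_finite_approx_set assms by blast
    then have "m < nat k" "(h, int (nat k)) \<in> approx_set \<alpha>"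
      by auto
    then show "\<exists>q>m. \<exists>p. (p, int q) \<in> approx_set \<alpha>"
      by blast
  qed
  then obtain q :: "nat \<Rightarrow> nat" where q: "strict_mono q" "\<And>n. \<exists>p. (p, int (q n)) \<in> approx_set \<alpha>"
    using frequently_subseq[of "\<lambda>_ q. \<exists>p. (p, int q) \<in> approx_set \<alpha>"] by blast
  obtain p where "\<And>n. (p n, int (q n)) \<in> approx_set \<alpha>"
    using q(2) by metis
  with q(1) show thesis using that by blast
qed

section \<open>The Denjoy-Koksma bound for the sawtooth\<close>

text \<open>The unperturbed point lies in the \<open>i\<close>-th cell of length
  \<open>1 / q\<close>, so an error below \<open>1 / q\<close> can cross an integer only from the
  first or the last cell. Written with indicators, the bound sums to a constant over all
  cells.\<close>

lemma frac_perturb: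
  fixes i q :: int
  assumes i: "0 \<le> i" "i < q" and s: "0 \<le> s" "s < 1 / q" and e: "\<bar>e\<bar> < 1 / q"
  shows "\<bar>frac (s + i / q + e) - (s + i / q)\<bar> \<le> 1 / q + (if i = 0 then 1 else 0) + (if i = q - 1 then 1 else 0)"
proof -
  have q: "1 \<le> q" using i by linarith
  define z where "z = s + i / q"
  have q1: "1 / real_of_int q \<le> 1"
    using q by simp
  have "0 \<le> z"
    using s i by (simp add: z_def)
  have "z < 1 / q + i / q"
    using s by (simp add: z_def)
  also have "\<dots> \<le> 1"
    using i q by (simp add: field_simps)
  finally have "z < 1" .
  consider "0 \<le> z + e" "z + e < 1" | "z + e < 0" | "1 \<le> z + e" by linarith
  then have "\<bar>frac (z + e) - z\<bar> \<le> 1 / q + (if i = 0 then 1 else 0) + (if i = q - 1 then 1 else 0)"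
  proof cases
    case 1
    then have "frac (z + e) = z + e" by (simp add: frac_eq)
    then show ?thesis using e by auto
  next
    case 2
    have "i = 0"
    proof (rule ccontr)
      assume "i \<noteq> 0"
      then have "1 / real_of_int q \<le> i / q"
        using i q by (intro divide_right_mono) auto
      then show False using 2 s e by (simp add: z_def)
    qed
    moreover have "frac (z + e) = z + e + 1"
      using 2 \<open>0 \<le> z\<close> e q1 by (intro frac_unique_iff[THEN iffD2]) auto
    ultimately show ?thesis using e by auto
  next
    case 3
    have "i = q - 1"
    proof (rule ccontr)
      assume "i \<noteq> q - 1"
      then have "i \<le> q - 2" using i by linarith
      then have "i / q \<le> (q - 2) / q"
        using q by (intro divide_right_mono) auto
      also have "\<dots> = 1 - 2 / q"
        using q by (simp add: field_simps)
      finally show False using 3 s e by (simp add: z_def)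
    qed
    moreover have "frac (z + e) = z + e - 1"
      using 3 \<open>z < 1\<close> e q1 by (intro frac_unique_iff[THEN iffD2]) auto
    ultimately show ?thesis using e by auto
  qed
  then show ?thesis by (simp add: z_def)
qed

text \<open>Because \<open>p\<close> is invertible modulo \<open>q\<close>, the progression meets
  every residue exactly once.\<close>

lemma sum_residues:
  fixes p a :: int and q :: nat and G :: "int \<Rightarrow> real"
  assumes q: "0 < q" and cop: "coprime p (int q)"
  shows "(\<Sum>j<q. G ((a + int j * p) mod int q)) = (\<Sum>i\<in>{0..<int q}. G i)"
proof -
  let ?f = "\<lambda>j::nat. (a + int j * p) mod int q"
  have inj: "inj_on ?f {..<q}"
  proof (rule inj_onI)
    fix j k assume jk: "j \<in> {..<q}" "k \<in> {..<q}" and "?f j = ?f k"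
    then have "int q dvd (int j - int k) * p"
      by (simp add: mod_eq_dvd_iff left_diff_distrib)
    then have "int q dvd int j - int k"
      using cop by (simp add: coprime_dvd_mult_left_iff coprime_commute)
    then have "int j mod int q = int k mod int q"
      by (simp add: mod_eq_dvd_iff)
    then show "j = k" using jk by simp
  qed
  have "?f ` {..<q} = {0..<int q}"
    using q by (intro card_subset_eq) (auto simp: card_image[OF inj])
  then show ?thesis
    using sum.reindex[OF inj, of G] by simp
qed

text \<open>Replacing \<open>\<alpha>\<close> by \<open>p / q\<close> turns the orbit modulo 1 into
  the equally spaced points \<open>s + i / q\<close>, each visited once. This costs at most 3, and
  the equally spaced sum \<open>real q * s - 1 / 2\<close> is at most 1/2 in absolute value.\<close>

lemma denjoy_koksma_sawtooth:
  assumes "(p, int q) \<in> approx_set \<alpha>"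
  shows "\<bar>\<Sum>j<q. (frac (y + real j * \<alpha>) - 1 / 2)\<bar> \<le> 4"
proof -
  note c = approx_setD[OF assms]
  \<comment> \<open>Here \<open>y = a / q + s\<close> with \<open>0 \<le> s < 1 / q\<close>;
    \<open>e j\<close> is the drift after \<open>j\<close> steps and \<open>i j\<close> the cell
    that is visited.\<close>
  define a where "a = \<lfloor>real q * y\<rfloor>"
  define s where "s = y - a / q"
  define e where "e j = real j * (\<alpha> - p / q)" for j
  define i where "i j = (a + int j * p) mod int q" for j
  have rq: "0 < real q" using c(1) by simp
  have s: "0 \<le> s" "s < 1 / q"
  proof -
    have "0 \<le> (real q * y - a) / q" "(real q * y - a) / q < 1 / q"
      using rq by (auto simp: a_def intro!: divide_strict_right_mono, linarith)
    moreover have "(real q * y - a) / q = s"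
      using rq by (simp add: s_def diff_divide_distrib)
    ultimately show "0 \<le> s" "s < 1 / q" by auto
  qed
  have e: "\<bar>e j\<bar> < 1 / q" if "j < q" for j
  proof -
    have "\<bar>e j\<bar> = real j * \<bar>\<alpha> - p / q\<bar>"
      by (simp add: e_def abs_mult)
    also have "\<dots> \<le> real q * \<bar>\<alpha> - p / q\<bar>"
      using that by (intro mult_right_mono) auto
    also have "\<dots> < real q * (1 / (real q)\<^sup>2)"
      using c(3) rq by (intro mult_strict_left_mono) auto
    also have "\<dots> = 1 / real q"
      using rq by (simp add: power2_eq_square)
    finally show ?thesis .
  qed
  have fr: "frac (y + real j * \<alpha>) = frac (s + i j / q + e j)" for j
  proof -
    define t where "t = (a + int j * p) div int q"
    have "a + int j * p = t * int q + i j"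
      unfolding t_def i_def by simp
    then have "real_of_int (a + int j * p) = real_of_int (t * int q + i j)"
      by simp
    then have "real_of_int a + real j * p = t * real q + i j"
      by simp
    then have "(real_of_int a + real j * p) / q = t + i j / q"
      using rq by (simp add: field_simps)
    then have "y + real j * \<alpha> = s + i j / q + e j + of_int t"
      by (simp add: s_def e_def algebra_simps add_divide_distrib)
    then show ?thesis by simp
  qed
  let ?z = "\<lambda>i::int. s + i / q"
  let ?w = "\<lambda>i::int. 1 / real q + (if i = 0 then 1 else 0) + (if i = int q - 1 then 1 else 0)"
  have "\<bar>\<Sum>j<q. (frac (y + real j * \<alpha>) - ?z (i j))\<bar> \<le> (\<Sum>j<q. \<bar>frac (y + real j * \<alpha>) - ?z (i j)\<bar>)"
    by (rule sum_abs)
  also have "\<dots> \<le> (\<Sum>j<q. ?w (i j))"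
  proof (rule sum_mono)
    fix j assume "j \<in> {..<q}"
    then show "\<bar>frac (y + real j * \<alpha>) - ?z (i j)\<bar> \<le> ?w (i j)"
      using frac_perturb[of "i j" "int q" s "e j"] s e[of j] c(1) by (simp add: fr i_def)
  qed
  also have "\<dots> = (\<Sum>i\<in>{0..<int q}. ?w i)"
    unfolding i_def by (rule sum_residues[OF c(1,2)])
  \<comment> \<open>The \<open>q\<close> terms \<open>1 / q\<close> give 1, and the two end cells
    give 1 each.\<close>
  also have "\<dots> = 3"
    using c(1) by (simp add: sum.distrib)
  finally have 1: "\<bar>\<Sum>j<q. (frac (y + real j * \<alpha>) - ?z (i j))\<bar> \<le> 3" .
  have "(\<Sum>j<q. ?z (i j) - 1/2) = (\<Sum>i\<in>{0..<int q}. ?z i - 1/2)"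
    unfolding i_def by (rule sum_residues[OF c(1,2)])
  also have "\<dots> = (\<Sum>k<q. s + real k / q - 1/2)"
    by (rule sum.reindex_bij_witness[of _ int nat]) auto
  also have "\<dots> = real q * s - real q / 2 + (\<Sum>k<q. real k) / q"
    by (simp add: sum.distrib sum_subtractf sum_divide_distrib)
  also have "(\<Sum>k<q. real k) = real q * (real q - 1) / 2"
    by (induction q) (auto simp: field_simps)
  also have "real q * s - real q / 2 + real q * (real q - 1) / 2 / q = real q * s - 1/2"
    using rq by (simp add: field_simps)
  finally have 2: "(\<Sum>j<q. ?z (i j) - 1/2) = real q * s - 1/2" .
  have "0 \<le> real q * s" "real q * s < 1"
    using s rq by (auto simp: field_simps)
  moreover have "(\<Sum>j<q. (frac (y + real j * \<alpha>) - 1 / 2)) =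
      (\<Sum>j<q. (frac (y + real j * \<alpha>) - ?z (i j))) + (\<Sum>j<q. ?z (i j) - 1/2)"
    by (simp flip: sum.distrib)
  ultimately show ?thesis
    using 1 2 by linarith
qed

text \<open>\<open>M\<close> collects the integer parts. The sum on the right is independent of
  \<open>x\<close> and \<open>b\<close>, so modulo 1 two coordinates differ only by \<open>q\<close>
  times the difference of their shifts.\<close>

lemma sawtooth_sum_mod_1:
  "\<exists>M::int. (\<Sum>j<q. (frac (x + real j * \<alpha> + b) - 1 / 2)) =
     real q * x + real q * b + (\<Sum>j<q. (real j * \<alpha> - 1 / 2)) - of_int M"
proof
  show "(\<Sum>j<q. (frac (x + real j * \<alpha> + b) - 1 / 2)) =
     real q * x + real q * b + (\<Sum>j<q. (real j * \<alpha> - 1 / 2)) - of_int (\<Sum>j<q. \<lfloor>x + real j * \<alpha> + b\<rfloor>)"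
    by (simp add: frac_def sum.distrib sum_subtractf)
qed

section \<open>Invariant sets of the skew product\<close>

text \<open>The Birkhoff sum of the cocycle, lifted to the line: \<open>frac\<close> absorbs the
  period, so addition of \<alpha> replaces \<open>rotation\<close>.\<close>

definition sawtooth_sum :: "real \<Rightarrow> ('n::finite \<Rightarrow> real) \<Rightarrow> nat \<Rightarrow> real \<Rightarrow> real ^ 'n" where
  "sawtooth_sum \<alpha> b n x = (\<chi> k. \<Sum>j<n. (frac (x + real j * \<alpha> + b k) - 1 / 2))"

lemma abs_sawtooth_sum_le:
  fixes b :: "'n::finite \<Rightarrow> real"
  assumes "(p, int q) \<in> approx_set \<alpha>"
  shows "\<bar>sawtooth_sum \<alpha> b q x $ k\<bar> \<le> 4"
proof -
  have "(\<Sum>j<q. (frac (x + real j * \<alpha> + b k) - 1 / 2)) = (\<Sum>j<q. (frac ((x + b k) + real j * \<alpha>) - 1 / 2))"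
    by (simp add: ac_simps)
  then show ?thesis
    using denjoy_koksma_sawtooth[OF assms, of "x + b k"] by (simp add: sawtooth_sum_def)
qed

lemma sawtooth_sum_Suc:
  "sawtooth_sum \<alpha> b (Suc n) x = sawtooth_sum \<alpha> b n x + sawtooth_sum \<alpha> b 1 (x + real n * \<alpha>)"
  by (simp add: sawtooth_sum_def vec_eq_iff)

text \<open>The set is lifted to the line and periodic in the base, so translation results for
  \<open>lborel\<close> apply without wrapping around. The assumption \<open>generic\<close> is what
  almost every \<beta> provides: along good denominators \<open>q b k\<close> approaches
  \<open>v k\<close> modulo 1 up to an offset \<open>y\<close> common to all coordinates, which the
  choice of times depending on \<open>x\<close> absorbs.\<close>

locale invariant_set =
  fixes \<alpha> :: real and b :: "'n::finite \<Rightarrow> real" and S :: "(real \<times> (real ^ 'n)) set"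
  assumes irrational: "\<alpha> \<notin> \<rat>"
    and borel [measurable]: "S \<in> sets borel"
    and periodic: "(x + 1, g) \<in> S \<longleftrightarrow> (x, g) \<in> S"
    and invariant: "(x + \<alpha>, g + sawtooth_sum \<alpha> b 1 x) \<in> S \<longleftrightarrow> (x, g) \<in> S"
    and generic: "\<exists>q p y K. strict_mono q \<and> (\<forall>n. (p n, int (q n)) \<in> approx_set \<alpha>) \<and>
      (\<forall>k. (\<lambda>n::nat. real (q n) * b k + y n - v k - of_int (K n k)) \<longlonglongrightarrow> 0)"
begin

definition fibre :: "real \<Rightarrow> (real ^ 'n) set" where
  "fibre x = {g. (x, g) \<in> S}"

lemma borel_fibre: "fibre x \<in> sets borel"
  unfolding fibre_def by measurable

lemma periodic_nat: "(x + real n, g) \<in> S \<longleftrightarrow> (x, g) \<in> S"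
proof (induction n)
  case (Suc n)
  then show ?case
    using periodic[of "x + real n" g] by (simp add: ac_simps)
qed simp

lemma periodic_int: "(x + of_int m, g) \<in> S \<longleftrightarrow> (x, g) \<in> S"
proof (cases "m \<ge> 0")
  case True
  then show ?thesis
    using periodic_nat[of x "nat m" g] by simp
next
  case False
  then show ?thesis
    using periodic_nat[of "x + of_int m" "nat (- m)" g] by simp
qed

lemma invariant_iterate: "(x + real n * \<alpha>, g + sawtooth_sum \<alpha> b n x) \<in> S \<longleftrightarrow> (x, g) \<in> S"
proof (induction n)
  case 0
  show ?case by (simp add: sawtooth_sum_def flip: zero_vec_def)
next
  case (Suc n)
  then show ?case
    using invariant[of "x + real n * \<alpha>" "g + sawtooth_sum \<alpha> b n x"]
    by (simp add: sawtooth_sum_Suc[of \<alpha> b n] algebra_simps)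
qed

text \<open>Modulo 1 a coordinate of the Birkhoff sum splits into \<open>q x + c q - y\<close>,
  small at suitable times for almost every \<open>x\<close>, and \<open>q b k + y\<close>, which
  tends to \<open>v k\<close>. Boundedness yields an accumulation point \<open>l\<close>, and the
  return of \<open>q \<alpha>\<close> to 0 modulo 1 puts it in the stabilizer.\<close>

lemma limit_in_stabilizer:
  fixes v :: "'n \<Rightarrow> real"
  shows "AE x in lborel. \<exists>l\<in>stabilizer (fibre x). \<forall>k. \<bar>l $ k\<bar> \<le> 4 \<and> l $ k - v k \<in> \<int>"
proof -
  obtain q p y K where q: "strict_mono q" and good: "\<And>n. (p n, int (q n)) \<in> approx_set \<alpha>"
    and lim: "\<And>k. (\<lambda>n::nat. real (q n) * b k + y n - v k - of_int (K n k)) \<longlonglongrightarrow> 0"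
    using generic[of v] by blast
  \<comment> \<open>The base displacement after \<open>q n\<close> steps, once periodicity has
    removed the integer \<open>p n\<close>.\<close>
  define h where "h n = (real (q n) * \<alpha> - of_int (p n), 0 :: real ^ 'n)" for n
  have "(\<lambda>n. real (q n) * \<alpha> - of_int (p n)) \<longlonglongrightarrow> 0"
  proof (rule Lim_null_comparison)
    show "(\<lambda>n. 1 / real (q n)) \<longlonglongrightarrow> 0"
      using filterlim_compose[OF lim_1_over_n filterlim_subseq[OF q]] .
    show "\<forall>\<^sub>F n in sequentially. norm (real (q n) * \<alpha> - of_int (p n)) \<le> 1 / real (q n)"
      using approx_setD(4)[OF good] by (simp add: less_imp_le)
  qed
  then have "h \<longlonglongrightarrow> 0"
    unfolding h_def zero_prod_def by (intro tendsto_Pair) auto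
  \<comment> \<open>\<open>r1\<close> is extracted before \<open>x\<close> is fixed; the later
    subsequences \<open>r2\<close> and \<open>r3\<close> depend on \<open>x\<close>.\<close>
  then obtain r1 where r1: "strict_mono r1"
    "AE z in lborel. \<forall>\<^sub>F n in sequentially. z + h (r1 n) \<in> S \<longleftrightarrow> z \<in> S"
    using AE_translation_subseq[OF borel] by blast
  have recur: "AE x in lborel. AE g in lborel. \<forall>\<^sub>F n in sequentially. (x, g) + h (r1 n) \<in> S \<longleftrightarrow> (x, g) \<in> S"
    using r1(2) unfolding lborel_prod[symmetric] by (rule lborel_pair.AE_pair)
  define c where "c n = (\<Sum>j<n. (real j * \<alpha> - 1 / 2))" for n
  have "AE x in lborel. \<exists>\<^sub>\<infinity>n. near_int (1 / real (Suc m))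
      (real (q (r1 n)) * x + (c (q (r1 n)) - y (r1 n)))" for m
    using AE_near_int[of "q \<circ> r1" "1 / real (Suc m)" "\<lambda>n. c (q (r1 n)) - y (r1 n)"] q r1(1)
    by (simp add: strict_mono_o)
  then have "AE x in lborel. \<forall>m. \<exists>\<^sub>\<infinity>n. near_int (1 / real (Suc m))
      (real (q (r1 n)) * x + (c (q (r1 n)) - y (r1 n)))"
    unfolding AE_all_countable by blast
  then show ?thesis
    using recur
  proof eventually_elim
    case (elim x)
    obtain r2 where r2: "strict_mono r2" "\<And>m. near_int (1 / real (Suc m))
        (real (q (r1 (r2 m))) * x + (c (q (r1 (r2 m))) - y (r1 (r2 m))))"
      using frequently_subseq[of "\<lambda>m n. near_int (1 / real (Suc m))
        (real (q (r1 n)) * x + (c (q (r1 n)) - y (r1 n)))"] elim(1) by blast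
    define r where "r m = r1 (r2 m)" for m
    have r: "strict_mono r"
      using r1(1) r2(1) by (simp add: r_def strict_mono_def)
    obtain L where L: "\<And>m. \<bar>real (q (r m)) * x + (c (q (r m)) - y (r m)) - of_int (L m)\<bar> < 1 / real (Suc m)"
      using r2(2) unfolding near_int_def r_def by metis
    have limL: "(\<lambda>m. real (q (r m)) * x + (c (q (r m)) - y (r m)) - of_int (L m)) \<longlonglongrightarrow> 0"
      by (rule Lim_null_comparison[OF _ LIMSEQ_Suc[OF lim_1_over_n]])
         (use L in \<open>simp add: less_imp_le\<close>)
    define F where "F m = sawtooth_sum \<alpha> b (q (r m)) x" for m
    have "\<exists>M::int. F m $ k = real (q (r m)) * x + real (q (r m)) * b k + c (q (r m)) - of_int M" for m k
      unfolding F_def sawtooth_sum_def c_def using sawtooth_sum_mod_1[of x \<alpha> "b k" "q (r m)"] by simp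
    then obtain M where M: "\<And>m k. F m $ k = real (q (r m)) * x + real (q (r m)) * b k + c (q (r m)) - of_int (M m k)"
      by metis
    have limF: "(\<lambda>m. F m $ k - v k - of_int (L m + K (r m) k - M m k)) \<longlonglongrightarrow> 0" for k
    proof -
      \<comment> \<open>The offsets \<open>y\<close> cancel: \<open>limL\<close> controls the part
        common to all coordinates, \<open>lim\<close> the part depending on
        \<open>k\<close>.\<close>
      have "(\<lambda>m. (real (q (r m)) * x + (c (q (r m)) - y (r m)) - of_int (L m)) +
          (real (q (r m)) * b k + y (r m) - v k - of_int (K (r m) k))) \<longlonglongrightarrow> 0 + 0"
        using LIMSEQ_subseq_LIMSEQ[OF lim[of k] r] by (intro tendsto_add limL) (simp add: o_def)
      then show ?thesis
        by (simp add: M algebra_simps)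
    qed
    have F4: "\<bar>F m $ k\<bar> \<le> 4" for m k
      unfolding F_def by (rule abs_sawtooth_sum_le[OF good])
    have "norm (F m) \<le> (\<Sum>k\<in>(UNIV::'n set). 4)" for m
      using norm_le_l1_cart[of "F m"] sum_mono[of UNIV "\<lambda>k. \<bar>F m $ k\<bar>" "\<lambda>_. 4"] F4 by fastforce
    then have "bounded (range F)"
      unfolding bounded_iff by blast
    then obtain l r3 where r3: "strict_mono r3" "(F \<circ> r3) \<longlonglongrightarrow> l"
      using bounded_imp_convergent_subsequence by blast
    have lk: "(\<lambda>m. F (r3 m) $ k) \<longlonglongrightarrow> l $ k" for k
      using tendsto_vec_nth[OF r3(2)] by (simp add: o_def)
    have "\<bar>l $ k\<bar> \<le> 4" for k
      using tendsto_rabs[OF lk[of k]] F4 by (intro LIMSEQ_le_const2[of _ "\<bar>l $ k\<bar>" 4]) auto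
    moreover have "l $ k - v k \<in> \<int>" for k
    proof -
      \<comment> \<open>The difference of these two sequences is integer valued, and the integers
        are closed.\<close>
      have "(\<lambda>m. (F (r3 m) $ k - v k) - (F (r3 m) $ k - v k - of_int (L (r3 m) + K (r (r3 m)) k - M (r3 m) k)))
          \<longlonglongrightarrow> (l $ k - v k) - 0"
        using LIMSEQ_subseq_LIMSEQ[OF limF[of k] r3(1)] lk[of k]
        by (intro tendsto_diff tendsto_const) (simp_all add: o_def)
      then have "(\<lambda>m. of_int (L (r3 m) + K (r (r3 m)) k - M (r3 m) k) :: real) \<longlonglongrightarrow> l $ k - v k"
        by (simp add: add_diff_eq)
      then show ?thesis
        using closed_sequentially[OF closed_Ints, of "\<lambda>m. of_int (L (r3 m) + K (r (r3 m)) k - M (r3 m) k)"]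
        by simp
    qed
    moreover have "l \<in> stabilizer (fibre x)"
    proof -
      \<comment> \<open>After \<open>q (r m)\<close> steps from \<open>(x, g - F m)\<close> the
        fibre coordinate is \<open>g\<close>, and the base coordinate is \<open>x\<close> displaced
        by \<open>h (r m)\<close> up to an integer.\<close>
      have eq: "(g - F m \<in> fibre x) \<longleftrightarrow> (x, g) + h (r m) \<in> S" for g m
        using invariant_iterate[of x "q (r m)" "g - F m"]
          periodic_int[of "x + real (q (r m)) * \<alpha>" "- p (r m)" g]
        by (simp add: F_def fibre_def h_def algebra_simps)
      have "AE g in lborel. \<forall>\<^sub>F m in sequentially. g + - F (r3 m) \<in> fibre x \<longleftrightarrow> g \<in> fibre x"
        using elim(2)
      proof eventually_elim
        case (elim g)
        have "strict_mono (\<lambda>m. r2 (r3 m))"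
          using r2(1) r3(1) by (simp add: strict_mono_def)
        from eventually_subseq[OF this elim] show ?case
          by (simp only: eq[symmetric, unfolded r_def] diff_conv_add_uminus fibre_def mem_Collect_eq)
      qed
      moreover have "(\<lambda>m. - F (r3 m)) \<longlonglongrightarrow> - l"
        using tendsto_minus[OF r3(2)] by (simp add: o_def)
      ultimately have "- l \<in> stabilizer (fibre x)"
        using stabilizer_limit[OF borel_fibre] by blast
      then show ?thesis
        using stabilizer_minus by fastforce
    qed
    ultimately show ?case by blast
  qed
qed

text \<open>
  If every multiple \<open>(j / N!) v\<close> lies in the stabilizer up to one of \<open>N\<close> integer vectors, two of the
  multiples \<open>0, \<dots>, N\<close> share that vector, and their difference \<open>(i / N!) v\<close> with \<open>i dvd N!\<close> generates \<open>v\<close>.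
\<close>

lemma vector_in_stabilizer:
  fixes v :: "real ^ 'n"
  shows "AE x in lborel. v \<in> stabilizer (fibre x)"
proof -
  \<comment> \<open>Coordinates of \<open>l j\<close> are at most 4 and those of \<open>w j\<close>
    at most \<open>norm v\<close> for \<open>j \<le> N\<close>, so \<open>B\<close> bounds their
    integer differences.\<close>
  define B where "B = \<lceil>4 + norm v\<rceil>"
  define P where "P = (UNIV :: 'n set) \<rightarrow>\<^sub>E {- B..B}"
  define N where "N = card P"
  have "finite P"
    unfolding P_def by (intro finite_PiE) auto
  have "B \<ge> 0"
    unfolding B_def using norm_ge_zero[of v] by linarith
  then have "P \<noteq> {}"
    by (auto simp: P_def PiE_eq_empty_iff)
  then have "N > 0"
    using \<open>finite P\<close> by (simp add: N_def card_gt_0_iff)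
  define w where "w j = (real j / fact N) *\<^sub>R v" for j :: nat
  have "AE x in lborel. \<forall>j. \<exists>l\<in>stabilizer (fibre x). \<forall>k. \<bar>l $ k\<bar> \<le> 4 \<and> l $ k - w j $ k \<in> \<int>"
    unfolding AE_all_countable using limit_in_stabilizer by blast
  then show ?thesis
  proof eventually_elim
    case (elim x)
    then obtain l where l: "\<And>j. l j \<in> stabilizer (fibre x)" "\<And>j k. \<bar>l j $ k\<bar> \<le> 4" "\<And>j k. l j $ k - w j $ k \<in> \<int>"
      by metis
    define f where "f j = (\<lambda>k. \<lfloor>l j $ k - w j $ k\<rfloor>)" for j
    have f: "of_int (f j k) = l j $ k - w j $ k" for j k
      using l(3)[of j k] by (auto simp: f_def elim: Ints_cases)
    have "f j \<in> P" if "j \<le> N" for j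
    proof -
      have "real j \<le> fact N"
        using that fact_ge_self[of N] by (metis of_nat_fact of_nat_mono order_trans)
      then have "norm (w j) \<le> norm v"
        using mult_right_mono[of "real j / fact N" 1 "norm v"] by (simp add: w_def)
      then have wk: "\<bar>w j $ k\<bar> \<le> norm v" for k
        using component_le_norm_cart[of "w j" k] by linarith
      have "\<bar>of_int (f j k)\<bar> \<le> 4 + norm v" for k
        unfolding f using wk[of k] l(2)[of j k] abs_triangle_ineq4[of "l j $ k" "w j $ k"] by linarith
      then have "\<bar>f j k\<bar> \<le> B" for k
        unfolding B_def by (metis le_ceiling_iff of_int_abs ceiling_of_int ceiling_mono)
      then show ?thesis
        by (auto simp: P_def abs_le_iff minus_le_iff)
    qed
    then have "f ` {..N} \<subseteq> P" by auto
    then have "card (f ` {..N}) \<le> N"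
      using \<open>finite P\<close> by (simp add: N_def card_mono)
    then have "\<not> inj_on f {..N}"
      by (intro pigeonhole) simp
    then obtain i j where ij: "i < j" "j \<le> N" "f i = f j"
      unfolding inj_on_def by (metis atMost_iff linorder_neqE_nat)
    have "l j - l i = w j - w i"
      using f ij(3) by (simp add: vec_eq_iff) (smt (verit))
    also have "\<dots> = (real (j - i) / fact N) *\<^sub>R v"
      using ij by (simp add: w_def of_nat_diff diff_divide_distrib flip: scaleR_diff_left)
    finally have "(real (j - i) / fact N) *\<^sub>R v \<in> stabilizer (fibre x)"
      using stabilizer_diff[OF l(1)[of j] l(1)[of i]] by simp
    then have "real (fact N div (j - i)) *\<^sub>R ((real (j - i) / fact N) *\<^sub>R v) \<in> stabilizer (fibre x)"
      by (rule stabilizer_scaleR)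
    moreover have "(j - i) dvd fact N"
      using ij by (intro dvd_fact) auto
    then have "real (fact N div (j - i)) * (real (j - i) / fact N) = 1"
      using ij by (simp add: real_of_nat_div)
    ultimately show ?case by (simp only: scaleR_scaleR scaleR_one)
  qed
qed

section \<open>From trivial fibres to a trivial set\<close>

text \<open>The null set in \<open>vector_in_stabilizer\<close> depends on \<open>v\<close>. A
  countable dense set of vectors merges these null sets, and closedness of the stabilizer recovers
  all vectors.\<close>

lemma AE_fibre_trivial:
  "AE x in lborel. (AE g in lborel. g \<in> fibre x) \<or> (AE g in lborel. g \<notin> fibre x)"
proof -
  obtain D :: "(real ^ 'n) set" where D: "countable D" "\<And>X. open X \<Longrightarrow> X \<noteq> {} \<Longrightarrow> \<exists>d\<in>D. d \<in> X"
    using countable_dense_setE by blast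
  have "AE x in lborel. \<forall>v\<in>D. v \<in> stabilizer (fibre x)"
    using D(1) vector_in_stabilizer by (simp add: AE_ball_countable)
  then show ?thesis
  proof eventually_elim
    case (elim x)
    have "open (- stabilizer (fibre x))"
      using closed_stabilizer[OF borel_fibre] by (simp add: open_Compl)
    then have "stabilizer (fibre x) = UNIV"
      using D(2)[of "- stabilizer (fibre x)"] elim by auto
    then show ?case
      by (rule stabilizer_UNIV_imp_trivial[OF borel_fibre])
  qed
qed

text \<open>The set \<open>X\<close> of base points with conull fibre is invariant under \<alpha>
  and under integers, hence null or conull. If it is null, \<open>AE_fibre_trivial\<close> makes
  almost every fibre null.\<close>

lemma invariant_set_trivial:
  "(AE x in lborel. AE g in lborel. (x, g) \<in> S) \<or> (AE x in lborel. AE g in lborel. (x, g) \<notin> S)"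
proof -
  define X where "X = {x. AE g in lborel. (x, g) \<in> S}"
  have X: "X \<in> sets borel"
  proof -
    have S': "- S \<in> sets (lborel \<Otimes>\<^sub>M lborel)"
      unfolding lborel_prod using borel by auto
    have "X = {x \<in> space lborel. emeasure lborel (Pair x -` (- S)) = 0}"
      unfolding X_def by (subst AE_iff_measurable[OF _ refl]) (auto simp: vimage_def Compl_eq)
    also have "\<dots> \<in> sets lborel"
      using lborel.measurable_emeasure_Pair[OF S'] by measurable
    finally show ?thesis by simp
  qed
  have rot: "x + \<alpha> \<in> X \<longleftrightarrow> x \<in> X" for x
  proof -
    let ?s = "sawtooth_sum \<alpha> b 1 x"
    \<comment> \<open>Conullity of a fibre survives translation by a fixed vector, so the cocycle
      value can be inserted.\<close>
    have "(AE g in lborel. (x + \<alpha>, g) \<in> S) \<longleftrightarrow> (AE g in lborel. (x + \<alpha>, g + ?s) \<in> S)"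
      using AE_lborel_translation[of "\<lambda>g. (x + \<alpha>, g) \<in> S" ?s]
        AE_lborel_translation[of "\<lambda>g. (x + \<alpha>, g + ?s) \<in> S" "- ?s"]
      by (simp only: minus_add_cancel diff_add_cancel add_uminus_conv_diff) blast
    then show ?thesis
      by (simp only: X_def mem_Collect_eq invariant)
  qed
  have rotn: "x + real n * \<alpha> \<in> X \<longleftrightarrow> x \<in> X" for x n
  proof (induction n)
    case (Suc n)
    then show ?case
      using rot[of "x + real n * \<alpha>"] by (simp add: algebra_simps)
  qed simp
  have per: "x + of_int m \<in> X \<longleftrightarrow> x \<in> X" for x m
    by (simp add: X_def periodic_int)
  have "u \<in> stabilizer X" for u
  proof -
    \<comment> \<open>Kronecker's theorem: the numbers \<open>k * \<alpha> - m\<close> with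
      \<open>k > 0\<close> are dense, and each of these translations preserves
      \<open>X\<close>.\<close>
    have "\<exists>c. (\<forall>x. x + c \<in> X \<longleftrightarrow> x \<in> X) \<and> \<bar>c - u\<bar> < 1 / real (Suc n)" for n
    proof -
      obtain m k where mk: "k > 0" "\<bar>of_int k * \<alpha> - of_int m - u\<bar> < 1 / real (Suc n)"
        using sequence_of_fractional_parts_is_dense[OF irrational, of "1 / real (Suc n)" u]
        by (metis of_nat_0_less_iff zero_less_Suc zero_less_divide_1_iff)
      have "x + (of_int k * \<alpha> - of_int m) \<in> X \<longleftrightarrow> x \<in> X" for x
        using rotn[of x "nat k"] per[of "x + of_int k * \<alpha>" "- m"] mk(1) by (simp add: algebra_simps)
      with mk(2) show ?thesis by blast
    qed
    then obtain c where c: "\<And>n x. x + c n \<in> X \<longleftrightarrow> x \<in> X" "\<And>n. \<bar>c n - u\<bar> < 1 / real (Suc n)"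
      by metis
    have "(\<lambda>n. c n - u) \<longlonglongrightarrow> 0"
      by (rule Lim_null_comparison[OF _ LIMSEQ_Suc[OF lim_1_over_n]])
         (use c(2) in \<open>simp add: less_imp_le\<close>)
    then have "c \<longlonglongrightarrow> u"
      by (rule LIM_zero_cancel)
    then show ?thesis
      using c(1) by (intro stabilizer_limit[OF X]) auto
  qed
  then have "(AE x in lborel. x \<in> X) \<or> (AE x in lborel. x \<notin> X)"
    by (intro stabilizer_UNIV_imp_trivial[OF X]) auto
  then show ?thesis
  proof
    assume "AE x in lborel. x \<notin> X"
    then have "AE x in lborel. AE g in lborel. (x, g) \<notin> S"
      using AE_fibre_trivial by eventually_elim (simp add: X_def fibre_def)
    then show ?thesis ..
  qed (simp add: X_def)
qed

end

section \<open>From the line to the circle\<close>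

lemma near_int_perturb:
  assumes "near_int d x" "\<bar>x - x'\<bar> \<le> e"
  shows "near_int (d + e) x'"
proof -
  obtain k :: int where "\<bar>x - k\<bar> < d"
    using assms(1) by (auto simp: near_int_def)
  then have "\<bar>x' - k\<bar> < d + e"
    using assms(2) by linarith
  then show ?thesis
    by (auto simp: near_int_def)
qed

text \<open>One null set must serve all targets \<open>t\<close>. Rational targets and tolerances
  \<open>1 / Suc m\<close> form a countable family, and real targets follow by
  approximation.\<close>

lemma AE_multiples_dense:
  fixes q :: "nat \<Rightarrow> nat"
  assumes q: "strict_mono q"
  shows "AE \<beta> in (\<Pi>\<^sub>M i\<in>(UNIV :: 'd::finite set). circle).
    \<forall>t. \<exists>r K. strict_mono r \<and> (\<forall>i. (\<lambda>n::nat. real (q (r n)) * \<beta> i - t i - of_int (K n i)) \<longlonglongrightarrow> 0)"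
proof -
  have "AE \<beta> in (\<Pi>\<^sub>M i\<in>(UNIV :: 'd set). circle). \<forall>(s :: 'd \<Rightarrow> rat) m.
      \<exists>\<^sub>\<infinity>n. \<forall>i. near_int (1 / real (Suc m)) (real (q n) * \<beta> i + - of_rat (s i))"
    unfolding AE_all_countable
  proof (intro allI)
    fix s :: "'d \<Rightarrow> rat" and m
    have "AE \<beta> in (\<Pi>\<^sub>M i\<in>(UNIV :: 'd set). circle).
        \<exists>\<^sub>\<infinity>n. \<forall>i\<in>UNIV. near_int (1 / real (Suc m)) (real (q n) * \<beta> i + - of_rat (s i))"
      by (rule AE_PiM_near_int[OF finite q]) simp
    then show "AE \<beta> in (\<Pi>\<^sub>M i\<in>(UNIV :: 'd set). circle).
        \<exists>\<^sub>\<infinity>n. \<forall>i. near_int (1 / real (Suc m)) (real (q n) * \<beta> i + - of_rat (s i))"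
      by (simp only: ball_UNIV)
  qed
  then show ?thesis
  proof eventually_elim
    case (elim \<beta>)
    show ?case
    proof
      fix t :: "'d \<Rightarrow> real"
      \<comment> \<open>One \<open>1 / Suc m\<close> pays for the rational approximation of
        \<open>t\<close>, the other for the distance to an integer.\<close>
      have "\<exists>\<^sub>\<infinity>n. \<forall>i. near_int (1 / real (Suc m) + 1 / real (Suc m)) (real (q n) * \<beta> i - t i)" for m
      proof -
        have "\<exists>s :: rat. \<bar>of_rat s - t i\<bar> \<le> 1 / real (Suc m)" for i
        proof -
          obtain s where "t i < of_rat s" "of_rat s < t i + 1 / real (Suc m)"
            using of_rat_dense[of "t i" "t i + 1 / real (Suc m)"] by auto
          then have "\<bar>of_rat s - t i\<bar> \<le> 1 / real (Suc m)"
            by linarith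
          then show ?thesis ..
        qed
        then obtain s :: "'d \<Rightarrow> rat" where s: "\<And>i. \<bar>of_rat (s i) - t i\<bar> \<le> 1 / real (Suc m)"
          by metis
        have "\<exists>\<^sub>\<infinity>n. \<forall>i. near_int (1 / real (Suc m)) (real (q n) * \<beta> i + - of_rat (s i))"
          using elim by blast
        then show ?thesis
        proof (rule INFM_mono, intro allI)
          fix n i
          assume "\<forall>i. near_int (1 / real (Suc m)) (real (q n) * \<beta> i + - of_rat (s i))"
          then show "near_int (1 / real (Suc m) + 1 / real (Suc m)) (real (q n) * \<beta> i - t i)"
            using s[of i] by (intro near_int_perturb[of _ "real (q n) * \<beta> i + - of_rat (s i)"]) auto
        qed
      qed
      then obtain r :: "nat \<Rightarrow> nat" where r: "strict_mono r"
        "\<And>m. \<forall>i. near_int (1 / real (Suc m) + 1 / real (Suc m)) (real (q (r m)) * \<beta> i - t i)"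
        using frequently_subseq[of "\<lambda>m n. \<forall>i. near_int (1 / real (Suc m) + 1 / real (Suc m)) (real (q n) * \<beta> i - t i)"]
        by blast
      then obtain K where K: "\<And>m i. \<bar>real (q (r m)) * \<beta> i - t i - of_int (K m i)\<bar> < 1 / real (Suc m) + 1 / real (Suc m)"
        unfolding near_int_def by metis
      have "(\<lambda>n. 1 / real (Suc n) + 1 / real (Suc n)) \<longlonglongrightarrow> 0"
        using tendsto_add[OF LIMSEQ_Suc[OF lim_1_over_n] LIMSEQ_Suc[OF lim_1_over_n]] by simp
      then have "(\<lambda>n. real (q (r n)) * \<beta> i - t i - of_int (K n i)) \<longlonglongrightarrow> 0" for i
      proof (rule Lim_null_comparison[rotated])
        show "\<forall>\<^sub>F n in sequentially. norm (real (q (r n)) * \<beta> i - t i - of_int (K n i))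
            \<le> 1 / real (Suc n) + 1 / real (Suc n)"
          unfolding real_norm_def by (intro always_eventually allI less_imp_le K)
      qed
      with r(1) show "\<exists>r K. strict_mono r \<and> (\<forall>i. (\<lambda>n::nat. real (q (r n)) * \<beta> i - t i - of_int (K n i)) \<longlonglongrightarrow> 0)"
        by blast
    qed
  qed
qed

section \<open>Measure preservation by the rotation and the skew product\<close>

lemma borel_measurable_frac [measurable]: "(frac :: real \<Rightarrow> real) \<in> borel_measurable borel"
  unfolding frac_def[abs_def] by measurable

lemma measurable_frac_circle [measurable]: "frac \<in> borel \<rightarrow>\<^sub>M circle"
  unfolding circle_def
  by (intro measurable_restrict_space2) (auto simp: frac_lt_1)

lemma measurable_ident_circle [measurable]: "(\<lambda>x. x) \<in> circle \<rightarrow>\<^sub>M borel"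
  by (simp add: circle_def measurable_restrict_space1)

lemma measurable_rotation [measurable]: "rotation a \<in> circle \<rightarrow>\<^sub>M circle"
  unfolding rotation_def by (rule measurable_compose[OF _ measurable_frac_circle]) measurable

text \<open>The preimage splits into the points that do not wrap around, translated by
  \<open>a\<close>, and those that do, translated by \<open>a - 1\<close>; each piece is a translate
  of a part of \<open>A\<close>.\<close>

lemma distr_rotation:
  assumes "0 < a" "a < 1"
  shows "distr circle circle (rotation a) = circle"
proof (rule measure_eqI)
  fix A assume "A \<in> sets (distr circle circle (rotation a))"
  then have A: "A \<in> sets circle" by simp
  then have sub: "A \<subseteq> {0..<1}" and Ab [measurable]: "A \<in> sets borel"
    by (auto simp: sets_restrict_space_iff dest: sets.sets_into_space)
  have em: "emeasure circle B = emeasure lborel B" if "B \<subseteq> {0..<1}" for B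
    unfolding circle_def using that by (intro emeasure_restrict_space) auto
  let ?B1 = "{x. x + a \<in> A \<inter> {a..}}" and ?B2 = "{x. x + (a - 1) \<in> A \<inter> {..<a}}"
  have "rotation a -` A \<inter> space circle = ?B1 \<union> ?B2"
  proof -
    have "frac (x + a) = (if x + a < 1 then x + a else x + (a - 1))" if "0 \<le> x" "x < 1" for x
      using that assms by (auto simp: frac_unique_iff)
    then show ?thesis
      using sub assms by (auto simp: rotation_def split: if_splits)
  qed
  moreover have "?B1 \<union> ?B2 \<subseteq> {0..<1}"
    using assms by (auto dest!: subsetD[OF sub])
  ultimately have "emeasure (distr circle circle (rotation a)) A = emeasure lborel (?B1 \<union> ?B2)"
    using A by (simp add: emeasure_distr em)
  also have "\<dots> = emeasure lborel ?B1 + emeasure lborel ?B2"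
  proof (rule plus_emeasure[symmetric])
    show "?B1 \<in> sets lborel" "?B2 \<in> sets lborel"
      unfolding sets_lborel by measurable
    show "?B1 \<inter> ?B2 = {}"
      by (auto dest!: subsetD[OF sub])
  qed
  also have "\<dots> = emeasure lborel (A \<inter> {a..}) + emeasure lborel (A \<inter> {..<a})"
    by (subst (1 2) emeasure_lborel_translation) auto
  also have "\<dots> = emeasure lborel ((A \<inter> {a..}) \<union> (A \<inter> {..<a}))"
    by (intro plus_emeasure) auto
  also have "(A \<inter> {a..}) \<union> (A \<inter> {..<a}) = A"
    by auto
  also have "emeasure lborel A = emeasure circle A"
    using em[OF sub] by simp
  finally show "emeasure (distr circle circle (rotation a)) A = emeasure circle A" .
qed simp

lemma measurable_skew_product:
  fixes \<Phi> :: "'a \<Rightarrow> 'b::euclidean_space"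
  assumes [measurable]: "T \<in> M \<rightarrow>\<^sub>M M" "\<Phi> \<in> borel_measurable M"
  shows "skew_product T \<Phi> \<in> (M \<Otimes>\<^sub>M lborel) \<rightarrow>\<^sub>M (M \<Otimes>\<^sub>M lborel)"
  unfolding skew_product_def by measurable

text \<open>By Fubini: over each \<open>x\<close> the map translates the fibre by
  \<open>\<Phi> x\<close>, which preserves \<open>lborel\<close>, and the base is handled by the
  invariance of \<open>M\<close>.\<close>

lemma distr_skew_product:
  fixes \<Phi> :: "'a \<Rightarrow> 'b::euclidean_space"
  assumes T [measurable]: "T \<in> M \<rightarrow>\<^sub>M M" and [measurable]: "\<Phi> \<in> borel_measurable M"
    and inv: "distr M M T = M"
  shows "distr (M \<Otimes>\<^sub>M lborel) (M \<Otimes>\<^sub>M lborel) (skew_product T \<Phi>) = M \<Otimes>\<^sub>M lborel"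
proof (rule measure_eqI)
  fix A assume "A \<in> sets (distr (M \<Otimes>\<^sub>M lborel) (M \<Otimes>\<^sub>M lborel) (skew_product T \<Phi>))"
  then have A [measurable]: "A \<in> sets (M \<Otimes>\<^sub>M lborel)" by simp
  note sk [measurable] = measurable_skew_product[OF assms(1,2)]
  let ?A' = "skew_product T \<Phi> -` A \<inter> space (M \<Otimes>\<^sub>M lborel)"
  have "emeasure (distr (M \<Otimes>\<^sub>M lborel) (M \<Otimes>\<^sub>M lborel) (skew_product T \<Phi>)) A = emeasure (M \<Otimes>\<^sub>M lborel) ?A'"
    by (rule emeasure_distr[OF sk A])
  also have "\<dots> = (\<integral>\<^sup>+x. emeasure lborel (Pair x -` ?A') \<partial>M)"
    by (intro lborel.emeasure_pair_measure_alt) measurable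
  also have "\<dots> = (\<integral>\<^sup>+x. emeasure lborel (Pair (T x) -` A) \<partial>M)"
  proof (rule nn_integral_cong)
    fix x assume "x \<in> space M"
    then have "Pair x -` ?A' = {g. g + \<Phi> x \<in> Pair (T x) -` A}"
      by (auto simp: skew_product_def space_pair_measure)
    then show "emeasure lborel (Pair x -` ?A') = emeasure lborel (Pair (T x) -` A)"
      using emeasure_lborel_translation[of "Pair (T x) -` A" "\<Phi> x"] sets_Pair1[OF A, of "T x"] by simp
  qed
  also have "\<dots> = (\<integral>\<^sup>+x. emeasure lborel (Pair x -` A) \<partial>distr M M T)"
    by (intro nn_integral_distr[symmetric] T) (simp add: lborel.measurable_emeasure_Pair A)
  also have "\<dots> = emeasure (M \<Otimes>\<^sub>M lborel) A"
    unfolding inv by (intro lborel.emeasure_pair_measure_alt[symmetric] A)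
  finally show "emeasure (distr (M \<Otimes>\<^sub>M lborel) (M \<Otimes>\<^sub>M lborel) (skew_product T \<Phi>)) A = emeasure (M \<Otimes>\<^sub>M lborel) A" .
qed simp

text \<open>Links the cocycle on the circle with its lift to the line; the 0 in
  \<open>case_option\<close> is the shift of the coordinate \<open>None\<close>.\<close>

lemma shifted_tuple_sawtooth:
  "shifted_tuple sawtooth \<beta> (frac x) = sawtooth_sum \<alpha> (case_option 0 \<beta>) 1 x"
  by (auto simp: vec_eq_iff shifted_tuple_def sawtooth_sum_def sawtooth_def rotation_def split: option.split)

text \<open>An invariant set is extended periodically to the line, where
  \<open>invariant_set_trivial\<close> applies; restricting to the circle gives the
  dichotomy.\<close>

lemma ergodic_cocycle_sawtooth:
  fixes \<beta> :: "'d::finite \<Rightarrow> real"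
  assumes \<alpha>: "0 < \<alpha>" "\<alpha> < 1" "\<alpha> \<notin> \<rat>"
    and q: "strict_mono q" "\<And>n. (p n, int (q n)) \<in> approx_set \<alpha>"
    and dense: "\<forall>t. \<exists>r K. strict_mono r \<and> (\<forall>i. (\<lambda>n::nat. real (q (r n)) * \<beta> i - t i - of_int (K n i)) \<longlonglongrightarrow> 0)"
  shows "ergodic_cocycle circle (rotation \<alpha>) (shifted_tuple sawtooth \<beta>)"
proof -
  define b where "b = case_option 0 \<beta>"
  let ?\<Phi> = "shifted_tuple sawtooth \<beta>"
  let ?M = "circle \<Otimes>\<^sub>M (lborel :: (real ^ 'd option) measure)"
  let ?T = "skew_product (rotation \<alpha>) ?\<Phi>"
  have ss [measurable]: "sawtooth_sum \<alpha> b 1 \<in> borel_measurable borel"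
    unfolding sawtooth_sum_def
    by (subst borel_measurable_euclidean_space) (auto simp: Basis_vec_def inner_axis)
  have "?\<Phi> \<in> borel_measurable circle \<longleftrightarrow> sawtooth_sum \<alpha> b 1 \<in> borel_measurable circle"
  proof (rule measurable_cong)
    fix x assume "x \<in> space circle"
    then have "frac x = x" by (simp add: frac_eq)
    then show "?\<Phi> x = sawtooth_sum \<alpha> b 1 x"
      using shifted_tuple_sawtooth[of \<beta> x \<alpha>] by (simp add: b_def)
  qed
  then have \<Phi>: "?\<Phi> \<in> borel_measurable circle"
    using measurable_compose[OF measurable_ident_circle ss] by blast
  interpret pair_sigma_finite circle "lborel :: (real ^ 'd option) measure"
    by (intro pair_sigma_finite.intro sigma_finite_circle lborel.sigma_finite_measure_axioms)
  have "A \<in> null_sets ?M \<or> space ?M - A \<in> null_sets ?M"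
    if A: "A \<in> sets ?M" and inv: "?T -` A \<inter> space ?M = A" for A
  proof -
    define S where "S = {z. (frac (fst z), snd z) \<in> A}"
    have collect: "{z \<in> space ?M. z \<in> A} = A" "{z \<in> space ?M. z \<notin> A} = space ?M - A"
      using sets.sets_into_space[OF A] by blast+
    have "(\<lambda>z. (frac (fst z), snd z)) \<in> borel \<rightarrow>\<^sub>M ?M"
      unfolding borel_prod[symmetric] by measurable
    from measurable_sets[OF this A] have S: "S \<in> sets borel"
      by (simp add: S_def vimage_def)
    interpret invariant_set \<alpha> b S
    proof
      show "\<alpha> \<notin> \<rat>" "S \<in> sets borel" by fact+
      show "(x + 1, g) \<in> S \<longleftrightarrow> (x, g) \<in> S" for x g
        by (simp add: S_def frac_1_eq)
      show "(x + \<alpha>, g + sawtooth_sum \<alpha> b 1 x) \<in> S \<longleftrightarrow> (x, g) \<in> S" for x g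
      proof -
        have "(frac x, g) \<in> ?T -` A \<inter> space ?M \<longleftrightarrow> (frac x, g) \<in> A"
          by (simp only: inv)
        then have "?T (frac x, g) \<in> A \<longleftrightarrow> (frac x, g) \<in> A"
          by (simp add: space_pair_measure frac_lt_1)
        then show ?thesis
          by (simp add: S_def skew_product_def rotation_def shifted_tuple_sawtooth[of \<beta> x \<alpha>] b_def)
      qed
      show "\<exists>q p y K. strict_mono q \<and> (\<forall>n. (p n, int (q n)) \<in> approx_set \<alpha>) \<and>
        (\<forall>k. (\<lambda>n::nat. real (q n) * b k + y n - v k - of_int (K n k)) \<longlonglongrightarrow> 0)" for v
      proof -
        \<comment> \<open>Since \<open>b None = 0\<close>, the offset \<open>v None\<close> settles
          that coordinate exactly, with integer 0. The others need only the differences from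
          \<open>v None\<close>.\<close>
        obtain r K where r: "strict_mono r"
          "\<And>i. (\<lambda>n::nat. real (q (r n)) * \<beta> i - (v (Some i) - v None) - of_int (K n i)) \<longlonglongrightarrow> 0"
          using dense[rule_format, of "\<lambda>i. v (Some i) - v None"] by blast
        have "(\<lambda>n. real (q (r n)) * b k + v None - v k - of_int (case_option 0 (K n) k)) \<longlonglongrightarrow> 0" for k
          using r(2) by (cases k) (auto simp: b_def algebra_simps)
        then show ?thesis
          using q r(1) by (intro exI[of _ "\<lambda>n. q (r n)"] exI[of _ "\<lambda>n. p (r n)"] exI[of _ "\<lambda>_. v None"]
              exI[of _ "\<lambda>n. case_option 0 (K n)"]) (auto simp: strict_mono_def)
      qed
    qed
    have mem: "(x, g) \<in> S \<longleftrightarrow> (x, g) \<in> A" if "0 \<le> x" "x < 1" for x g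
      using that by (simp add: S_def frac_eq[THEN iffD2])
    from invariant_set_trivial show ?thesis
    proof
      assume "AE x in lborel. AE g in lborel. (x, g) \<in> S"
      then have "AE x in circle. AE g in lborel. (x, g) \<in> A"
        unfolding AE_circle_iff by eventually_elim (auto simp: mem)
      then have "AE z in ?M. z \<in> A"
        by (intro AE_pair_measure) (simp_all only: collect A)
      then have "AE z in ?M. z \<notin> space ?M - A"
        by eventually_elim blast
      then have "space ?M - A \<in> null_sets ?M"
        using AE_iff_null_sets[OF sets.compl_sets[OF A]] by blast
      then show ?thesis ..
    next
      assume "AE x in lborel. AE g in lborel. (x, g) \<notin> S"
      then have "AE x in circle. AE g in lborel. (x, g) \<notin> A"
        unfolding AE_circle_iff by eventually_elim (auto simp: mem)
      then have "AE z in ?M. z \<notin> A"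
        by (intro AE_pair_measure) (simp_all only: collect sets.compl_sets[OF A])
      then have "A \<in> null_sets ?M"
        using AE_iff_null_sets[OF A] by blast
      then show ?thesis ..
    qed
  qed
  then show ?thesis
    unfolding ergodic_cocycle_def ergodic_def
    by (intro conjI ballI impI \<Phi> measurable_skew_product[OF measurable_rotation \<Phi>]
        distr_skew_product[OF measurable_rotation \<Phi> distr_rotation[OF \<alpha>(1,2)]]) blast
qed

text \<open>The denominators are chosen from \<alpha> alone, so the density of multiples along this
  one sequence discards a single null set of \<beta>.\<close>

theorem proposition4p6:
  fixes \<alpha> :: real
  assumes "0 < \<alpha>" and "\<alpha> < 1" and "\<alpha> \<notin> \<rat>"
  shows "AE \<beta> in (\<Pi>\<^sub>M i\<in>(UNIV :: 'd::finite set). circle).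
           ergodic_cocycle circle (rotation \<alpha>) (shifted_tuple sawtooth \<beta>)"
proof -
  obtain p :: "nat \<Rightarrow> int" and q :: "nat \<Rightarrow> nat" where pq: "strict_mono q" "\<And>n. (p n, int (q n)) \<in> approx_set \<alpha>"
    using approx_set_strict_mono[OF assms(3)] by blast
  show ?thesis
    using AE_multiples_dense[OF pq(1)]
    by eventually_elim (rule ergodic_cocycle_sawtooth[OF assms pq])
qed

end
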